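(* Let $\mathcal{R}\subseteq 2^\omega$ be the class of $m$-rigid sets. Then $\mu(\mathcal{R})=1$. Moreover, every Martin-Löf random set $A\in 2^\omega$ is $m$-rigid.
   Context: $\omega=\{0,1,2,\dots\}$; sets $A\subseteq\omega$ are identified with their characteristic functions in Cantor space $2^\omega$. For a finite binary string $\sigma$, $[\sigma]=\{X\in 2^\omega:\sigma \text{ is an initial segment of } X\}$, and $\mu$ is the fair-coin product measure on $2^\omega$, determined by $\mu([\sigma])=2^{-|\sigma|}$. A total computable function $k:\omega\to\omega$ is an $m$-autoreduction of $A$ if for all $x$, $x\in A\iff k(x)\in A$. The set $A$ is $m$-rigid if every $m$-autoreduction $k$ of $A$ is eventually the identity, i.e. $k(x)=x$ for all but finitely many $x$. A Martin-Löf test is a sequence $(U_n)_{n\in\omega}$ of uniformly c.e. open subsets of $2^\omega$ (i.e. $U_n=\bigcup_{\sigma\in W_n}[\sigma]$ for a uniformly computably enumerable sequence $(W_n)_{n\in\omega}$ of sets of finite binary strings) such that $\mu(U_n)\le 2^{-n}$ for all $n$. A set $X\in 2^\omega$ is Martin-Löf random if $X\notin\bigcap_n U_n$ for every Martin-Löf test $(U_n)_{n\in\omega}$. *)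

theory Defs
  imports "HOL-Probability.Probability"
begin

datatype recf =
    Zero
  | Succ
  | Proj nat
  | Comp recf "recf list"
  | PrimRec recf recf
  | Mu recf

text \<open>
  \<open>computes p xs y\<close>: program \<open>p\<close> halts on the argument tuple \<open>xs\<close> with value \<open>y\<close>.
  Programs carry no arity: for each \<open>n\<close>, a program denotes a partial function of \<open>n\<close> arguments,
  undefined on tuples of unsuitable length. Composition is strict, recursion is on the first
  argument, and minimisation requires all smaller values to be defined.
\<close>

inductive computes :: "recf \<Rightarrow> nat list \<Rightarrow> nat \<Rightarrow> bool" where
  Zero: "computes Zero xs 0"
| Succ: "computes Succ [x] (Suc x)"
| Proj: "i < length xs \<Longrightarrow> computes (Proj i) xs (xs ! i)"
| Comp: "length ys = length gs \<Longrightarrow> (\<forall>i < length gs. computes (gs ! i) xs (ys ! i)) \<Longrightarrow>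
         computes f ys z \<Longrightarrow> computes (Comp f gs) xs z"
| PrimRec_0: "computes f xs y \<Longrightarrow> computes (PrimRec f g) (0 # xs) y"
| PrimRec_Suc: "computes (PrimRec f g) (n # xs) r \<Longrightarrow> computes g (n # r # xs) y \<Longrightarrow>
         computes (PrimRec f g) (Suc n # xs) y"
| Mu: "computes f (y # xs) 0 \<Longrightarrow> (\<forall>z < y. \<exists>v. computes f (z # xs) (Suc v)) \<Longrightarrow>
         computes (Mu f) xs y"

lemma computes_deterministic:
  "computes p xs y \<Longrightarrow> computes p xs y' \<Longrightarrow> y = y'"
proof (induction arbitrary: y' rule: computes.induct)
  case (Comp ys gs xs f z)
  from Comp.prems show ?case
  proof cases
    case (Comp ys')
    then have "ys' = ys"
      using Comp.IH(1) Comp.hyps(1) by (auto intro!: nth_equalityI)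
    then show ?thesis using Comp Comp.IH(2) by blast
  qed
next
  case (PrimRec_0 f xs y g)
  from PrimRec_0.prems show ?case by cases (use PrimRec_0.IH in auto)
next
  case (PrimRec_Suc f g n xs r y)
  from PrimRec_Suc.prems show ?case by cases (use PrimRec_Suc.IH in auto)
next
  case (Mu f y xs)
  from Mu.prems show ?case
  proof cases
    case Mu
    then show ?thesis
      using Mu.IH by (metis linorder_neqE_nat nat.distinct(1))
  qed
qed (auto elim: computes.cases)

definition total_computable :: "(nat \<Rightarrow> nat) \<Rightarrow> bool" where
  "total_computable k \<longleftrightarrow> (\<exists>p. \<forall>x. computes p [x] (k x))"

text \<open>
  The code of \<open>\<sigma>\<close> is the number whose binary digits, least significant first, are \<open>\<sigma>\<close> followed
  by a final 1, which marks the length.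
\<close>

definition string_code :: "bool list \<Rightarrow> nat" where
  "string_code \<sigma> = horner_sum of_bool 2 (\<sigma> @ [True])"

lemma inj_string_code: "inj string_code"
proof (rule injI)
  fix \<sigma> \<tau> :: "bool list"
  have pos: "horner_sum of_bool (2::nat) (\<rho> @ [True]) \<noteq> 0" for \<rho>
    by (induction \<rho>) auto
  assume "string_code \<sigma> = string_code \<tau>"
  then show "\<sigma> = \<tau>" unfolding string_code_def
  proof (induction \<sigma> arbitrary: \<tau>)
    case Nil
    then show ?case using pos[of "tl \<tau>"] by (cases \<tau>; cases "hd \<tau>") auto
  next
    case (Cons b \<sigma>)
    show ?case
    proof (cases \<tau>)
      case Nil
      then show ?thesis using Cons.prems pos[of \<sigma>] by (cases b) auto
    next
      case (Cons c \<tau>')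
      have eq: "of_bool b + 2 * horner_sum of_bool (2::nat) (\<sigma> @ [True])
          = of_bool c + 2 * horner_sum of_bool 2 (\<tau>' @ [True])"
        using Cons.prems Cons by simp
      then have "b = c" by (cases b; cases c) (simp_all, presburger+)
      then show ?thesis using eq Cons Cons.IH by simp
    qed
  qed
qed

text \<open>Uniform computable enumerability: \<open>{(n, \<sigma>). \<sigma> \<in> W n}\<close> is the domain of a partial recursive
  function.\<close>

definition uniformly_ce :: "(nat \<Rightarrow> bool list set) \<Rightarrow> bool" where
  "uniformly_ce W \<longleftrightarrow> (\<exists>p. \<forall>n \<sigma>. \<sigma> \<in> W n \<longleftrightarrow> (\<exists>y. computes p [n, string_code \<sigma>] y))"

text \<open>A set of naturals is represented by its characteristic function \<open>A :: nat \<Rightarrow> bool\<close>.\<close>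

definition cylinder :: "bool list \<Rightarrow> (nat \<Rightarrow> bool) set" where
  "cylinder \<sigma> = {X. \<forall>i < length \<sigma>. X i = \<sigma> ! i}"

definition cantor_measure :: "(nat \<Rightarrow> bool) measure" where
  "cantor_measure = (\<Pi>\<^sub>M i\<in>UNIV. measure_pmf (bernoulli_pmf (1/2)))"

lemma measure_cylinder: "measure cantor_measure (cylinder \<sigma>) = (1/2) ^ length \<sigma>"
proof -
  let ?M = "\<lambda>_::nat. measure_pmf (bernoulli_pmf (1/2))"
  have cyl: "cylinder \<sigma> = prod_emb UNIV ?M {..<length \<sigma>} (\<Pi>\<^sub>E i\<in>{..<length \<sigma>}. {\<sigma> ! i})"
    unfolding cylinder_def prod_emb_def
    by (intro set_eqI) (simp only: vimage_def Int_iff mem_Collect_eq PiE_iff restrict_apply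
      space_measure_pmf lessThan_iff singleton_iff extensional_def UNIV_I, auto)
  interpret product_prob_space ?M UNIV
    by unfold_locales
  have "measure cantor_measure (cylinder \<sigma>)
      = (\<Prod>i<length \<sigma>. measure (measure_pmf (bernoulli_pmf (1/2))) {\<sigma> ! i})"
    unfolding cyl cantor_measure_def by (rule measure_PiM_emb) auto
  also have "\<dots> = (\<Prod>i<length \<sigma>. 1/2)"
  proof (rule prod.cong)
    fix i show "measure (measure_pmf (bernoulli_pmf (1/2))) {\<sigma> ! i} = 1/2"
      by (cases "\<sigma> ! i") (simp_all add: measure_pmf_single)
  qed simp
  finally show ?thesis by simp
qed

definition m_autoreduction :: "(nat \<Rightarrow> nat) \<Rightarrow> (nat \<Rightarrow> bool) \<Rightarrow> bool" where
  "m_autoreduction k A \<longleftrightarrow> total_computable k \<and> (\<forall>x. A x \<longleftrightarrow> A (k x))"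

definition m_rigid :: "(nat \<Rightarrow> bool) \<Rightarrow> bool" where
  "m_rigid A \<longleftrightarrow> (\<forall>k. m_autoreduction k A \<longrightarrow> finite {x. k x \<noteq> x})"

definition martin_loef_test :: "(nat \<Rightarrow> (nat \<Rightarrow> bool) set) \<Rightarrow> bool" where
  "martin_loef_test U \<longleftrightarrow>
     (\<exists>W. uniformly_ce W \<and> (\<forall>n. U n = (\<Union>\<sigma>\<in>W n. cylinder \<sigma>))) \<and>
     (\<forall>n. measure cantor_measure (U n) \<le> (1/2) ^ n)"

definition martin_loef_random :: "(nat \<Rightarrow> bool) \<Rightarrow> bool" where
  "martin_loef_random X \<longleftrightarrow> (\<forall>U. martin_loef_test U \<longrightarrow> X \<notin> (\<Inter>n. U n))"

end

theory Submission
  imports Defs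
begin

text \<open>
  Let \<open>k\<close> be computable with infinitely many non-fixed points, and call \<open>m\<close> linked if it is the
  larger element of some pair \<open>{x, k x}\<close> with \<open>k x \<noteq> x\<close>. There are infinitely many linked numbers,
  and if \<open>k\<close> is an autoreduction of \<open>A\<close>, then the bit of \<open>A\<close> at a linked \<open>m\<close> is determined by the
  bits below \<open>m\<close>. So the sets that respect \<open>k\<close> below \<open>L\<close> have measure at most \<open>2\<close> to the power of
  minus the number of linked \<open>m < L\<close>. Since linkedness is decidable, these sets form a
  Martin-Loef test. As there are only countably many computable functions, almost every set is
  \<open>m\<close>-rigid.
\<close>

section \<open>Total computable functions of several arguments\<close>

text \<open>Arguments form a single list, so the closure lemmas below serve every arity at once.
  Values on lists of other lengths are left open, which is why \<open>computable_fn_cong\<close>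
  compares only lists of length \<open>n\<close>.\<close>

definition computable_fn :: "nat \<Rightarrow> (nat list \<Rightarrow> nat) \<Rightarrow> bool" where
  "computable_fn n f \<longleftrightarrow> (\<exists>p. \<forall>xs. length xs = n \<longrightarrow> computes p xs (f xs))"

lemma computable_fn_cong:
  assumes "computable_fn n f" "\<And>xs. length xs = n \<Longrightarrow> f xs = g xs"
  shows "computable_fn n g"
  using assms unfolding computable_fn_def by metis

lemma computable_fn_comp:
  assumes f: "computable_fn (length gs) f" and gs: "\<And>g. g \<in> set gs \<Longrightarrow> computable_fn n g"
  shows "computable_fn n (\<lambda>xs. f (map (\<lambda>g. g xs) gs))"
proof -
  obtain p where p: "\<And>xs. length xs = length gs \<Longrightarrow> computes p xs (f xs)"
    using f unfolding computable_fn_def by auto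
  obtain P where P: "\<And>g xs. g \<in> set gs \<Longrightarrow> length xs = n \<Longrightarrow> computes (P g) xs (g xs)"
    using gs unfolding computable_fn_def by metis
  have "computes (Comp p (map P gs)) xs (f (map (\<lambda>g. g xs) gs))" if "length xs = n" for xs
    by (rule computes.Comp[where ys = "map (\<lambda>g. g xs) gs"]) (use p P that in auto)
  then show ?thesis unfolding computable_fn_def by blast
qed

lemma computable_fn_nth: "i < n \<Longrightarrow> computable_fn n (\<lambda>xs. xs ! i)"
  unfolding computable_fn_def by (metis computes.Proj)

text \<open>Bounded sums and quantifiers put their bound variable at the head of the list, so the
  outer arguments reappear in their bodies as entries of \<open>tl xs\<close>.\<close>

lemma computable_fn_nth_tl: "Suc i < n \<Longrightarrow> computable_fn n (\<lambda>xs. tl xs ! i)"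
  by (rule computable_fn_cong[OF computable_fn_nth[of "Suc i"]]) (auto simp: nth_tl)

lemma computable_fn_unary:
  assumes "total_computable k" "computable_fn n f"
  shows "computable_fn n (\<lambda>xs. k (f xs))"
proof -
  obtain p where "\<And>x. computes p [x] (k x)"
    using assms(1) unfolding total_computable_def by auto
  then have "computes p ys (k (hd ys))" if "length ys = 1" for ys
    using that by (cases ys) auto
  then have "computable_fn 1 (\<lambda>ys. k (hd ys))" unfolding computable_fn_def by blast
  with computable_fn_comp[of "[f]" "\<lambda>ys. k (hd ys)" n] show ?thesis
    using assms(2) by simp
qed

lemma computable_fn_Suc: "computable_fn n f \<Longrightarrow> computable_fn n (\<lambda>xs. Suc (f xs))"
  by (rule computable_fn_unary[of Suc]) (auto simp: total_computable_def intro: computes.Succ)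

lemma computable_fn_const: "computable_fn n (\<lambda>xs. c)"
proof (induction c)
  case 0
  then show ?case unfolding computable_fn_def by (metis computes.Zero)
qed (rule computable_fn_Suc)

text \<open>\<open>PrimRec\<close> recurses on its first argument; composing with \<open>c\<close>
  allows a computed recursion depth. The step function receives the counter, the previous value and
  then the parameters, hence \<open>drop 2 ys\<close>.\<close>

lemma computable_fn_primrec:
  assumes b: "computable_fn n b"
    and s: "computable_fn (Suc (Suc n)) (\<lambda>ys. s (ys ! 0) (ys ! 1) (drop 2 ys))"
    and c: "computable_fn n c"
  shows "computable_fn n (\<lambda>xs. rec_nat (b xs) (\<lambda>m r. s m r xs) (c xs))"
proof -
  define h where "h ys = rec_nat (b (tl ys)) (\<lambda>m r. s m r (tl ys)) (hd ys)" for ys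
  obtain p where p: "\<And>xs. length xs = n \<Longrightarrow> computes p xs (b xs)"
    using b unfolding computable_fn_def by auto
  obtain q where q: "\<And>ys. length ys = Suc (Suc n) \<Longrightarrow>
      computes q ys (s (ys ! 0) (ys ! 1) (drop 2 ys))"
    using s unfolding computable_fn_def by auto
  have rec: "computes (PrimRec p q) (m # xs) (rec_nat (b xs) (\<lambda>m r. s m r xs) m)"
    if "length xs = n" for m xs
  proof (induction m)
    case 0
    then show ?case using p that by (auto intro: computes.PrimRec_0)
  next
    case (Suc m)
    show ?case
      by (rule computes.PrimRec_Suc[OF Suc])
        (use q[of "m # rec_nat (b xs) (\<lambda>m r. s m r xs) m # xs"] that in simp)
  qed
  have "computes (PrimRec p q) ys (h ys)" if "length ys = Suc n" for ys
    using rec[of "tl ys" "hd ys"] that by (cases ys) (auto simp: h_def)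
  then have "computable_fn (Suc n) h" unfolding computable_fn_def by blast
  \<comment> \<open>Composing with \<open>c\<close> and all \<open>n\<close> projections feeds
    \<open>c xs # xs\<close> to \<open>h\<close>, so no parameter is lost.\<close>
  then have "computable_fn n (\<lambda>xs. h (map (\<lambda>g. g xs) (c # map (\<lambda>i xs. xs ! i) [0..<n])))"
    by (intro computable_fn_comp) (auto intro: c computable_fn_nth)
  then show ?thesis
  proof (rule computable_fn_cong)
    fix xs :: "nat list" assume "length xs = n"
    then have "map (\<lambda>i. xs ! i) [0..<n] = xs" using map_nth by blast
    then show "h (map (\<lambda>g. g xs) (c # map (\<lambda>i xs. xs ! i) [0..<n]))
        = rec_nat (b xs) (\<lambda>m r. s m r xs) (c xs)"
      by (simp add: h_def comp_def)
  qed
qed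

lemma computable_fn_add:
  assumes "computable_fn n f" "computable_fn n g"
  shows "computable_fn n (\<lambda>xs. f xs + g xs)"
proof -
  have "rec_nat a (\<lambda>_. Suc) b = a + b" for a b by (induction b) auto
  with computable_fn_primrec[OF assms(1) _ assms(2), of "\<lambda>m r xs. Suc r"] show ?thesis
    by (simp add: computable_fn_Suc computable_fn_nth)
qed

lemma computable_fn_pred:
  assumes "computable_fn n f"
  shows "computable_fn n (\<lambda>xs. f xs - 1)"
proof -
  have "rec_nat 0 (\<lambda>m _. m) a = a - 1" for a by (induction a) auto
  with computable_fn_primrec[OF computable_fn_const[of n 0] _ assms, of "\<lambda>m r xs. m"]
  show ?thesis by (simp add: computable_fn_nth)
qed

lemma computable_fn_diff:
  assumes "computable_fn n f" "computable_fn n g"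
  shows "computable_fn n (\<lambda>xs. f xs - g xs)"
proof -
  have "rec_nat a (\<lambda>_ r. r - 1) b = a - b" for a b :: nat by (induction b) auto
  with computable_fn_primrec[OF assms(1) _ assms(2), of "\<lambda>m r xs. r - 1"] show ?thesis
    using computable_fn_pred[OF computable_fn_nth[of 1]] by simp
qed

lemma computable_fn_half:
  assumes "computable_fn n f"
  shows "computable_fn n (\<lambda>xs. f xs div 2)"
proof -
  \<comment> \<open>Subtracting the rounded-down half of \<open>m\<close> from \<open>m\<close>
    leaves the rounded-up half, which is \<open>Suc m div 2\<close>. This recursion needs no case
    distinction on parity.\<close>
  have "rec_nat 0 (\<lambda>m r. m - r) a = a div 2" for a :: nat
  proof (induction a)
    case (Suc a)
    moreover have "a - a div 2 = Suc a div 2" by presburger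
    ultimately show ?case by simp
  qed simp
  with computable_fn_primrec[OF computable_fn_const[of n 0] _ assms, of "\<lambda>m r xs. m - r"]
  show ?thesis by (simp add: computable_fn_nth computable_fn_diff)
qed

lemma computable_fn_div_power2:
  assumes "computable_fn n f" "computable_fn n g"
  shows "computable_fn n (\<lambda>xs. f xs div 2 ^ g xs)"
proof -
  have "rec_nat a (\<lambda>_ r. r div 2) b = a div 2 ^ b" for a b :: nat
    by (induction b) (simp_all add: power_Suc2 div_mult2_eq del: power_Suc)
  with computable_fn_primrec[OF assms(1) _ assms(2), of "\<lambda>m r xs. r div 2"] show ?thesis
    by (simp add: computable_fn_half computable_fn_nth)
qed

lemma computable_fn_mod2:
  assumes "computable_fn n f"
  shows "computable_fn n (\<lambda>xs. f xs mod 2)"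
proof -
  have "computable_fn n (\<lambda>xs. f xs - (f xs div 2 + f xs div 2))"
    by (intro computable_fn_diff computable_fn_add computable_fn_half assms)
  then show ?thesis
    by (rule computable_fn_cong) (metis minus_mult_div_eq_mod mult_2)
qed

lemma computable_fn_sum:
  assumes f: "computable_fn (Suc n) (\<lambda>ys. f (ys ! 0) (tl ys))" and c: "computable_fn n c"
  shows "computable_fn n (\<lambda>xs. \<Sum>i<c xs. f i xs)"
proof -
  \<comment> \<open>These projections omit entry 1, the accumulator of the recursion, which the
    summand does not take.\<close>
  let ?gs = "(\<lambda>ys. ys ! 0) # map (\<lambda>i ys. ys ! (i + 2)) [0..<n]"
  have "computable_fn (Suc (Suc n)) (\<lambda>ys. (\<lambda>ys. f (ys ! 0) (tl ys)) (map (\<lambda>g. g ys) ?gs))"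
    by (rule computable_fn_comp) (use f in \<open>auto intro: computable_fn_nth\<close>)
  then have "computable_fn (Suc (Suc n)) (\<lambda>ys. f (ys ! 0) (drop 2 ys))"
  proof (rule computable_fn_cong)
    fix ys :: "nat list" assume "length ys = Suc (Suc n)"
    then have "map (\<lambda>i. ys ! (i + 2)) [0..<n] = drop 2 ys"
      by (intro nth_equalityI) (auto simp: add.commute)
    then show "(\<lambda>ys. f (ys ! 0) (tl ys)) (map (\<lambda>g. g ys) ?gs) = f (ys ! 0) (drop 2 ys)"
      by (simp add: comp_def)
  qed
  then have step: "computable_fn (Suc (Suc n)) (\<lambda>ys. ys ! 1 + f (ys ! 0) (drop 2 ys))"
    by (intro computable_fn_add computable_fn_nth) auto
  have "rec_nat 0 (\<lambda>m r. r + h m) a = (\<Sum>i<a. h i)" for h :: "nat \<Rightarrow> nat" and a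
    by (induction a) auto
  with computable_fn_primrec[OF computable_fn_const[of n 0] step c] show ?thesis by simp
qed

section \<open>Decidable predicates and bounded quantifiers\<close>

definition decidable_pred :: "nat \<Rightarrow> (nat list \<Rightarrow> bool) \<Rightarrow> bool" where
  "decidable_pred n P \<longleftrightarrow> computable_fn n (\<lambda>xs. of_bool (P xs))"

lemma decidable_pred_le:
  assumes "computable_fn n f" "computable_fn n g"
  shows "decidable_pred n (\<lambda>xs. f xs \<le> g xs)"
proof -
  \<comment> \<open>Truncated subtraction: the inner difference is 0 exactly when the inequality
    holds.\<close>
  have "computable_fn n (\<lambda>xs. 1 - (f xs - g xs))"
    by (intro computable_fn_diff computable_fn_const assms)
  then show ?thesis unfolding decidable_pred_def by (rule computable_fn_cong) auto
qed

lemma decidable_pred_not: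
  assumes "decidable_pred n P"
  shows "decidable_pred n (\<lambda>xs. \<not> P xs)"
  using computable_fn_diff[OF computable_fn_const[of n 1] assms[unfolded decidable_pred_def]]
  unfolding decidable_pred_def by (rule computable_fn_cong) auto

lemma decidable_pred_disj:
  assumes "decidable_pred n P" "decidable_pred n Q"
  shows "decidable_pred n (\<lambda>xs. P xs \<or> Q xs)"
proof -
  have "decidable_pred n (\<lambda>xs. 1 \<le> of_bool (P xs) + (of_bool (Q xs) :: nat))"
    using assms unfolding decidable_pred_def[of n P] decidable_pred_def[of n Q]
    by (intro decidable_pred_le computable_fn_const computable_fn_add)
  then show ?thesis unfolding decidable_pred_def by (rule computable_fn_cong) auto
qed

lemma decidable_pred_conj:
  assumes "decidable_pred n P" "decidable_pred n Q"
  shows "decidable_pred n (\<lambda>xs. P xs \<and> Q xs)"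
proof -
  have "decidable_pred n (\<lambda>xs. \<not> (\<not> P xs \<or> \<not> Q xs))"
    by (rule decidable_pred_not, rule decidable_pred_disj; rule decidable_pred_not, rule assms)
  then show ?thesis by simp
qed

lemma decidable_pred_imp:
  assumes "decidable_pred n P" "decidable_pred n Q"
  shows "decidable_pred n (\<lambda>xs. P xs \<longrightarrow> Q xs)"
  unfolding imp_conv_disj
  by (rule decidable_pred_disj[OF decidable_pred_not[OF assms(1)] assms(2)])

lemma decidable_pred_less:
  assumes "computable_fn n f" "computable_fn n g"
  shows "decidable_pred n (\<lambda>xs. f xs < g xs)"
  unfolding less_eq_Suc_le
  by (rule decidable_pred_le[OF computable_fn_Suc[OF assms(1)] assms(2)])

lemma decidable_pred_eq:
  assumes "computable_fn n f" "computable_fn n g"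
  shows "decidable_pred n (\<lambda>xs. f xs = g xs)"
  unfolding eq_iff by (intro decidable_pred_conj decidable_pred_le assms)

lemma decidable_pred_ex_less:
  assumes P: "decidable_pred (Suc n) (\<lambda>ys. P (ys ! 0) (tl ys))" and c: "computable_fn n c"
  shows "decidable_pred n (\<lambda>xs. \<exists>i<c xs. P i xs)"
proof -
  have "decidable_pred n (\<lambda>xs. 1 \<le> (\<Sum>i<c xs. of_bool (P i xs) :: nat))"
    by (intro decidable_pred_le computable_fn_const computable_fn_sum c
        P[unfolded decidable_pred_def])
  moreover have "1 \<le> (\<Sum>i<a. of_bool (Q i) :: nat) \<longleftrightarrow> (\<exists>i<a. Q i)" for a and Q :: "nat \<Rightarrow> bool"
    by (induction a) (auto simp: less_Suc_eq)
  ultimately show ?thesis by simp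
qed

lemma decidable_pred_all_less:
  assumes P: "decidable_pred (Suc n) (\<lambda>ys. P (ys ! 0) (tl ys))" and c: "computable_fn n c"
  shows "decidable_pred n (\<lambda>xs. \<forall>i<c xs. P i xs)"
proof -
  have "decidable_pred n (\<lambda>xs. \<not> (\<exists>i<c xs. \<not> P i xs))"
    by (rule decidable_pred_not, rule decidable_pred_ex_less[OF decidable_pred_not[OF P] c])
  then show ?thesis by simp
qed

lemmas computable_intros =
  computable_fn_nth computable_fn_nth_tl computable_fn_const computable_fn_div_power2
  computable_fn_mod2 computable_fn_sum decidable_pred_le decidable_pred_disj decidable_pred_conj
  decidable_pred_imp decidable_pred_less decidable_pred_eq decidable_pred_ex_less
  decidable_pred_all_less

section \<open>Enumerability by unbounded search, and string codes\<close>

text \<open>The program minimises over \<open>z\<close>. A total decision procedure never blocks the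
  search, so it halts exactly when a witness exists.\<close>

lemma decidable_pred_projection:
  assumes "decidable_pred (Suc n) P"
  obtains p where "\<And>xs. length xs = n \<Longrightarrow> (\<exists>y. computes p xs y) \<longleftrightarrow> (\<exists>z. P (z # xs))"
proof -
  \<comment> \<open>The truth value is negated because \<open>Mu\<close> looks for a zero.\<close>
  obtain q where q: "\<And>xs. length xs = Suc n \<Longrightarrow> computes q xs (of_bool (\<not> P xs))"
    using decidable_pred_not[OF assms] unfolding decidable_pred_def computable_fn_def by auto
  have "(\<exists>y. computes (Mu q) xs y) \<longleftrightarrow> (\<exists>z. P (z # xs))" if len: "length xs = n" for xs
  proof
    assume "\<exists>y. computes (Mu q) xs y"
    then obtain y where "computes (Mu q) xs y" by auto
    then have "computes q (y # xs) 0" by cases auto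
    then show "\<exists>z. P (z # xs)"
      using q[of "y # xs"] len computes_deterministic by fastforce
  next
    assume "\<exists>z. P (z # xs)"
    then obtain y where y: "P (y # xs)" "\<And>z. z < y \<Longrightarrow> \<not> P (z # xs)"
      using exists_least_iff[of "\<lambda>z. P (z # xs)"] by auto
    have "computes (Mu q) xs y"
    proof (rule computes.Mu)
      show "computes q (y # xs) 0" using q[of "y # xs"] y(1) len by simp
      show "\<forall>z<y. \<exists>v. computes q (z # xs) (Suc v)"
      proof (intro allI impI)
        fix z assume "z < y"
        then have "computes q (z # xs) (Suc 0)" using q[of "z # xs"] y(2)[of z] len by simp
        then show "\<exists>v. computes q (z # xs) (Suc v)" by blast
      qed
    qed
    then show "\<exists>y. computes (Mu q) xs y" by blast
  qed
  then show thesis using that by blast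
qed

lemma string_code_Cons: "string_code (b # \<sigma>) = of_bool b + 2 * string_code \<sigma>"
  by (simp add: string_code_def)

lemma string_code_Nil: "string_code [] = 1"
  by (simp add: string_code_def)

lemma string_code_nth:
  "i < length \<sigma> \<Longrightarrow> string_code \<sigma> div 2 ^ i mod 2 = of_bool (\<sigma> ! i)"
proof (induction \<sigma> arbitrary: i)
  case (Cons b \<sigma>)
  then show ?case
    by (cases i) (auto simp: string_code_Cons div_mult2_eq)
qed simp

text \<open>The final digit 1 places the code between \<open>2 ^ length \<sigma>\<close> and
  \<open>2 ^ Suc (length \<sigma>)\<close>, the upper end excluded. Lengths can thus be compared
  arithmetically, without decoding.\<close>

lemma power2_le_string_code_iff: "2 ^ L \<le> string_code \<sigma> \<longleftrightarrow> L \<le> length \<sigma>"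
proof (induction \<sigma> arbitrary: L)
  case Nil
  then show ?case using one_less_power[of "2 :: nat" L] by (cases L) (auto simp: string_code_Nil)
next
  case (Cons b \<sigma>)
  show ?case
  proof (cases L)
    case 0
    then show ?thesis using Cons[of 0] by (simp add: string_code_Cons)
  next
    case (Suc L')
    have "2 ^ L \<le> string_code (b # \<sigma>) \<longleftrightarrow> 2 ^ L' \<le> string_code \<sigma>"
      by (cases b) (simp_all add: Suc string_code_Cons, presburger)
    then show ?thesis using Cons[of L'] Suc by simp
  qed
qed

section \<open>Sets respecting a computable function\<close>

text \<open>The guard \<open>k x < L\<close> makes the condition depend on the first
  \<open>L\<close> bits only, so it can be tested on strings.\<close>

definition respects_below :: "(nat \<Rightarrow> nat) \<Rightarrow> nat \<Rightarrow> (nat \<Rightarrow> bool) \<Rightarrow> bool" where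
  "respects_below k L A \<longleftrightarrow> (\<forall>x<L. k x < L \<longrightarrow> A x = A (k x))"

text \<open>Only bounded conditions occur, so this is decidable for computable \<open>k\<close>,
  although the range of \<open>k\<close> need not be.\<close>

definition linked :: "(nat \<Rightarrow> nat) \<Rightarrow> nat \<Rightarrow> bool" where
  "linked k m \<longleftrightarrow> k m < m \<or> (\<exists>x<m. k x = m)"

definition linked_count :: "(nat \<Rightarrow> nat) \<Rightarrow> nat \<Rightarrow> nat" where
  "linked_count k L = (\<Sum>m<L. of_bool (linked k m))"

text \<open>
  Requiring some \<open>L \<le> length \<sigma>\<close> instead of \<open>L = length \<sigma>\<close> does not change the open set, and turns
  the domain of the enumerating program into a plain minimisation over \<open>L\<close>.
\<close>

definition test_strings :: "(nat \<Rightarrow> nat) \<Rightarrow> nat \<Rightarrow> bool list set" where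
  "test_strings k n =
     {\<sigma>. \<exists>L\<le>length \<sigma>. respects_below k L (\<lambda>i. \<sigma> ! i) \<and> n \<le> linked_count k L}"

lemma respects_below_mono: "L \<le> L' \<Longrightarrow> respects_below k L' A \<Longrightarrow> respects_below k L A"
  by (auto simp: respects_below_def)

lemma respects_below_cong:
  "(\<And>i. i < L \<Longrightarrow> A i = B i) \<Longrightarrow> respects_below k L A \<longleftrightarrow> respects_below k L B"
  by (auto simp: respects_below_def)

lemma respects_iff: "(\<forall>x. A x = A (k x)) \<longleftrightarrow> (\<forall>L. respects_below k L A)"
proof
  assume *: "\<forall>L. respects_below k L A"
  show "\<forall>x. A x = A (k x)"
  proof
    fix x
    show "A x = A (k x)"
      using *[rule_format, of "Suc (max x (k x))"] by (auto simp: respects_below_def less_Suc_eq_le)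
  qed
qed (auto simp: respects_below_def)

lemma uniformly_ce_test_strings:
  assumes k: "total_computable k"
  shows "uniformly_ce (test_strings k)"
proof -
  \<comment> \<open>The entries are \<open>L\<close>, \<open>n\<close> and the code of the string.
    \<open>L\<close> comes first because the projection searches over the head. The first conjunct
    says that the code is at least \<open>2 ^ L\<close>.\<close>
  define P where "P = (\<lambda>xs. 1 \<le> xs ! 2 div 2 ^ (xs ! 0) \<and>
    (\<forall>x<xs ! 0. k x < xs ! 0 \<longrightarrow> xs ! 2 div 2 ^ x mod 2 = xs ! 2 div 2 ^ k x mod 2) \<and>
    xs ! 1 \<le> (\<Sum>m<xs ! 0. of_bool (k m < m \<or> (\<exists>x<m. k x = m))))"
  have "decidable_pred (Suc 2) P"
    unfolding P_def
    by (intro computable_intros computable_fn_unary[OF k]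
        computable_fn_sum[of _ "\<lambda>m xs. of_bool (k m < m \<or> (\<exists>x<m. k x = m))"]
        decidable_pred_def[THEN iffD1]) auto
  then obtain p where p: "\<And>xs. length xs = 2 \<Longrightarrow> (\<exists>y. computes p xs y) \<longleftrightarrow> (\<exists>z. P (z # xs))"
    using decidable_pred_projection[of 2 P] by blast
  have "P [L, n, string_code \<sigma>] \<longleftrightarrow>
      L \<le> length \<sigma> \<and> respects_below k L (\<lambda>i. \<sigma> ! i) \<and> n \<le> linked_count k L" for L n \<sigma>
    unfolding P_def respects_below_def linked_count_def linked_def
    using power2_le_string_code_iff[of L \<sigma>]
    by (auto simp: string_code_nth Suc_le_eq div_greater_zero_iff of_bool_eq_iff)
  then have "\<sigma> \<in> test_strings k n \<longleftrightarrow> (\<exists>y. computes p [n, string_code \<sigma>] y)" for n \<sigma>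
    using p[of "[n, string_code \<sigma>]"] by (auto simp: test_strings_def)
  then show ?thesis unfolding uniformly_ce_def by blast
qed

text \<open>The first \<open>L\<close> bits decide whether a set respects \<open>k\<close> below
  \<open>L\<close>, so strings and sets can be exchanged. The sets on the right shrink as
  \<open>L\<close> grows, which makes the union easy to measure.\<close>

lemma UN_cylinder_test_strings:
  "(\<Union>\<sigma>\<in>test_strings k n. cylinder \<sigma>)
     = (\<Union>L\<in>{L. n \<le> linked_count k L}. {A. respects_below k L A})"
proof (intro set_eqI iffI)
  fix A assume "A \<in> (\<Union>\<sigma>\<in>test_strings k n. cylinder \<sigma>)"
  then obtain \<sigma> L where *: "A \<in> cylinder \<sigma>" "L \<le> length \<sigma>" "respects_below k L (\<lambda>i. \<sigma> ! i)"
    "n \<le> linked_count k L"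
    by (auto simp: test_strings_def)
  then have "respects_below k L A"
    using respects_below_cong[of L A "\<lambda>i. \<sigma> ! i" k] by (auto simp: cylinder_def)
  then show "A \<in> (\<Union>L\<in>{L. n \<le> linked_count k L}. {A. respects_below k L A})"
    using * by auto
next
  fix A assume "A \<in> (\<Union>L\<in>{L. n \<le> linked_count k L}. {A. respects_below k L A})"
  then obtain L where L: "n \<le> linked_count k L" "respects_below k L A" by auto
  then have "map A [0..<L] \<in> test_strings k n"
    using respects_below_cong[of L A "\<lambda>i. map A [0..<L] ! i" k]
    by (auto simp: test_strings_def intro!: exI[of _ L])
  moreover have "A \<in> cylinder (map A [0..<L])" by (auto simp: cylinder_def)
  ultimately show "A \<in> (\<Union>\<sigma>\<in>test_strings k n. cylinder \<sigma>)" by blast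
qed

section \<open>Counting and measuring the sets that respect a function\<close>

text \<open>Induction on \<open>L\<close>: appending a bit at most doubles the number of strings,
  and at a linked position the new bit is forced, so the number does not grow. The product form
  keeps the bound within the naturals.\<close>

lemma card_respecting_strings:
  "card {\<sigma>. length \<sigma> = L \<and> respects_below k L (\<lambda>i. \<sigma> ! i)} * 2 ^ linked_count k L \<le> 2 ^ L"
proof (induction L)
  case 0
  then show ?case by (simp add: respects_below_def linked_count_def)
next
  case (Suc L)
  define S where "S L = {\<sigma>. length \<sigma> = L \<and> respects_below k L (\<lambda>i. \<sigma> ! i)}" for L
  have fin: "finite (S L)" for L
    using finite_lists_length_eq[of "UNIV :: bool set" L] by (auto simp: S_def)
  have butlast: "butlast \<sigma> \<in> S L" if "\<sigma> \<in> S (Suc L)" for \<sigma>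
  proof -
    have "respects_below k L (\<lambda>i. \<sigma> ! i)"
      using that respects_below_mono[of L "Suc L"] by (auto simp: S_def)
    then show ?thesis
      using that respects_below_cong[of L "\<lambda>i. butlast \<sigma> ! i" "\<lambda>i. \<sigma> ! i" k]
      by (auto simp: S_def nth_butlast)
  qed
  have split: "butlast \<sigma> @ [\<sigma> ! L] = \<sigma>" if "\<sigma> \<in> S (Suc L)" for \<sigma>
  proof -
    have "\<sigma> \<noteq> []" "length \<sigma> = Suc L" using that by (auto simp: S_def)
    then show ?thesis using append_butlast_last_id[of \<sigma>] last_conv_nth[of \<sigma>] by simp
  qed
  show ?case
  proof (cases "linked k L")
    case True
    then obtain j where j: "j < L" "k L = j \<or> k j = L" by (auto simp: linked_def)
    have last: "\<sigma> ! L = butlast \<sigma> ! j" if "\<sigma> \<in> S (Suc L)" for \<sigma>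
      using that j by (auto simp: S_def respects_below_def nth_butlast)
    \<comment> \<open>The last bit repeats the bit at \<open>j\<close>, which survives in
      \<open>butlast\<close>, so nothing is lost by deleting it.\<close>
    have "inj_on butlast (S (Suc L))"
    proof (rule inj_onI)
      fix \<sigma> \<tau> assume "\<sigma> \<in> S (Suc L)" "\<tau> \<in> S (Suc L)" "butlast \<sigma> = butlast \<tau>"
      then show "\<sigma> = \<tau>" using last[of \<sigma>] last[of \<tau>] split[of \<sigma>] split[of \<tau>] by simp
    qed
    then have "card (S (Suc L)) \<le> card (S L)"
      using butlast fin by (intro card_inj_on_le) auto
    then have "card (S (Suc L)) * 2 ^ linked_count k L \<le> card (S L) * 2 ^ linked_count k L"
      by (rule mult_le_mono1)
    moreover have "linked_count k (Suc L) = Suc (linked_count k L)"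
      using True by (simp add: linked_count_def)
    ultimately show ?thesis
      using le_trans[OF _ Suc.IH[folded S_def]] unfolding S_def[symmetric] by simp
  next
    case False
    \<comment> \<open>Without a link, the trivial bound of two extensions per string
      suffices.\<close>
    have "S (Suc L) \<subseteq> (\<lambda>(\<sigma>, b). \<sigma> @ [b]) ` (S L \<times> UNIV)"
    proof
      fix \<sigma> assume \<sigma>: "\<sigma> \<in> S (Suc L)"
      then have "(\<lambda>(\<sigma>, b). \<sigma> @ [b]) (butlast \<sigma>, \<sigma> ! L) = \<sigma>" using split by simp
      then show "\<sigma> \<in> (\<lambda>(\<sigma>, b). \<sigma> @ [b]) ` (S L \<times> UNIV)"
        using butlast[OF \<sigma>] by (metis SigmaI UNIV_I image_eqI)
    qed
    then have "card (S (Suc L)) \<le> card (S L \<times> (UNIV :: bool set))"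
      by (rule surj_card_le[rotated]) (simp add: fin)
    then have "card (S (Suc L)) \<le> card (S L) * 2" by (simp add: card_cartesian_product)
    then have "card (S (Suc L)) * 2 ^ linked_count k L \<le> card (S L) * 2 * 2 ^ linked_count k L"
      by (rule mult_le_mono1)
    moreover have count: "linked_count k (Suc L) = linked_count k L"
      using False by (simp add: linked_count_def)
    ultimately show ?thesis
      using Suc.IH[folded S_def] unfolding S_def[symmetric] count power_Suc by linarith
  qed
qed

text \<open>\<open>measure\<close> takes the default value 0 on nonmeasurable sets, whereas a
  cylinder has positive measure.\<close>

lemma cylinder_in_sets: "cylinder \<sigma> \<in> sets cantor_measure"
proof (rule ccontr)
  assume "cylinder \<sigma> \<notin> sets cantor_measure"
  then have "measure cantor_measure (cylinder \<sigma>) = 0" by (rule measure_notin_sets)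
  then show False by (simp add: measure_cylinder)
qed

lemma respects_below_eq_UN:
  "{A. respects_below k L A}
     = (\<Union>\<sigma>\<in>{\<sigma>. length \<sigma> = L \<and> respects_below k L (\<lambda>i. \<sigma> ! i)}. cylinder \<sigma>)"
proof (intro set_eqI iffI)
  fix A assume "A \<in> {A. respects_below k L A}"
  then have "map A [0..<L] \<in> {\<sigma>. length \<sigma> = L \<and> respects_below k L (\<lambda>i. \<sigma> ! i)}"
    using respects_below_cong[of L A "\<lambda>i. map A [0..<L] ! i" k] by auto
  moreover have "A \<in> cylinder (map A [0..<L])" by (auto simp: cylinder_def)
  ultimately show "A \<in> (\<Union>\<sigma>\<in>{\<sigma>. length \<sigma> = L \<and> respects_below k L (\<lambda>i. \<sigma> ! i)}. cylinder \<sigma>)"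
    by blast
next
  fix A assume "A \<in> (\<Union>\<sigma>\<in>{\<sigma>. length \<sigma> = L \<and> respects_below k L (\<lambda>i. \<sigma> ! i)}. cylinder \<sigma>)"
  then obtain \<sigma> where "length \<sigma> = L" "respects_below k L (\<lambda>i. \<sigma> ! i)" "A \<in> cylinder \<sigma>" by auto
  then show "A \<in> {A. respects_below k L A}"
    using respects_below_cong[of L A "\<lambda>i. \<sigma> ! i" k] by (auto simp: cylinder_def)
qed

lemma finite_respecting_strings: "finite {\<sigma>. length \<sigma> = L \<and> respects_below k L (\<lambda>i. \<sigma> ! i)}"
  using finite_lists_length_eq[of "UNIV :: bool set" L] by auto

lemma respects_below_in_sets: "{A. respects_below k L A} \<in> sets cantor_measure"
  unfolding respects_below_eq_UN
  by (intro sets.finite_UN finite_respecting_strings cylinder_in_sets)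

lemma prob_space_cantor_measure: "prob_space cantor_measure"
  unfolding cantor_measure_def by (intro prob_space_PiM measure_pmf.prob_space_axioms)

lemma measure_respects_below:
  "measure cantor_measure {A. respects_below k L A} \<le> (1/2) ^ linked_count k L"
proof -
  interpret prob_space cantor_measure by (rule prob_space_cantor_measure)
  let ?S = "{\<sigma>. length \<sigma> = L \<and> respects_below k L (\<lambda>i. \<sigma> ! i)}"
  have "measure cantor_measure {A. respects_below k L A} \<le> (\<Sum>\<sigma>\<in>?S. measure cantor_measure (cylinder \<sigma>))"
    unfolding respects_below_eq_UN
    by (intro finite_measure_subadditive_finite finite_respecting_strings)
      (auto simp: cylinder_in_sets)
  also have "\<dots> = card ?S * (1/2) ^ L" by (simp add: measure_cylinder)
  also have "\<dots> \<le> (1/2) ^ linked_count k L"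
  proof -
    have "real (card ?S * 2 ^ linked_count k L) \<le> real (2 ^ L)"
      using card_respecting_strings[of L k] by (rule of_nat_mono)
    then show ?thesis by (simp add: field_simps)
  qed
  finally show ?thesis .
qed

text \<open>Each non-fixed \<open>x\<close> yields the linked number \<open>max x (k x)\<close>,
  which is at least \<open>x\<close>. Non-fixed points beyond every bound therefore give linked
  numbers beyond every bound.\<close>

lemma linked_count_unbounded:
  assumes inf: "infinite {x. k x \<noteq> x}"
  obtains L where "n \<le> linked_count k L"
proof -
  have "linked k (max x (k x))" if "k x \<noteq> x" for x
    using that by (cases "x < k x") (auto simp: linked_def max_def)
  then have "\<exists>m>b. linked k m" for b
    using inf unfolding infinite_nat_iff_unbounded by (meson less_max_iff_disj mem_Collect_eq)
  then have "infinite {m. linked k m}" by (simp add: infinite_nat_iff_unbounded)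
  then obtain F where F: "F \<subseteq> {m. linked k m}" "finite F" "card F = n"
    using infinite_arbitrarily_large by blast
  obtain L where "F \<subseteq> {..<L}" using F(2) finite_nat_bounded by blast
  then have "card F \<le> card ({..<L} \<inter> {m. linked k m})" using F by (intro card_mono) auto
  then have "n \<le> linked_count k L" using F by (simp add: linked_count_def)
  then show thesis by (rule that)
qed

section \<open>The Martin-Loef test and randomness\<close>

lemma martin_loef_test_test_strings:
  assumes k: "total_computable k" and inf: "infinite {x. k x \<noteq> x}"
  shows "martin_loef_test (\<lambda>n. \<Union>\<sigma>\<in>test_strings k n. cylinder \<sigma>)"
proof -
  interpret prob_space cantor_measure by (rule prob_space_cantor_measure)
  have "measure cantor_measure (\<Union>\<sigma>\<in>test_strings k n. cylinder \<sigma>) \<le> (1/2) ^ n" for n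
  proof -
    \<comment> \<open>Respecting \<open>k\<close> below a larger bound implies respecting it below a
      smaller one, so the whole union is contained in the set belonging to the least admissible
      \<open>L\<close>.\<close>
    define L where "L = (LEAST L. n \<le> linked_count k L)"
    have L: "n \<le> linked_count k L"
      unfolding L_def by (rule LeastI_ex) (meson linked_count_unbounded[OF inf])
    have "L \<le> L'" if "n \<le> linked_count k L'" for L'
      unfolding L_def using that by (rule Least_le)
    then have "(\<Union>\<sigma>\<in>test_strings k n. cylinder \<sigma>) \<subseteq> {A. respects_below k L A}"
      unfolding UN_cylinder_test_strings using respects_below_mono by blast
    then have "measure cantor_measure (\<Union>\<sigma>\<in>test_strings k n. cylinder \<sigma>)
        \<le> measure cantor_measure {A. respects_below k L A}"
      by (rule finite_measure_mono[OF _ respects_below_in_sets])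
    also have "\<dots> \<le> (1/2) ^ linked_count k L" by (rule measure_respects_below)
    also have "\<dots> \<le> (1/2) ^ n" using L by (intro power_decreasing) auto
    finally show ?thesis .
  qed
  then show ?thesis unfolding martin_loef_test_def using uniformly_ce_test_strings[OF k] by blast
qed

text \<open>A set with an autoreduction moving infinitely many numbers respects it below every
  bound, hence lies in every level of the corresponding test.\<close>

lemma martin_loef_random_imp_m_rigid:
  assumes "martin_loef_random A"
  shows "m_rigid A"
  unfolding m_rigid_def
proof (intro allI impI)
  fix k assume k: "m_autoreduction k A"
  show "finite {x. k x \<noteq> x}"
  proof (rule ccontr)
    assume inf: "infinite {x. k x \<noteq> x}"
    have "respects_below k L A" for L
      using k respects_iff[of A k] by (auto simp: m_autoreduction_def)
    then have "A \<in> (\<Union>\<sigma>\<in>test_strings k n. cylinder \<sigma>)" for n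
      unfolding UN_cylinder_test_strings using linked_count_unbounded[OF inf, of n] by blast
    then show False
      using assms martin_loef_test_test_strings[OF _ inf] k
      unfolding martin_loef_random_def m_autoreduction_def by blast
  qed
qed

section \<open>Almost every set is m-rigid\<close>

text \<open>The class lies in the sets respecting \<open>k\<close> below \<open>L\<close> for every
  \<open>L\<close>, and their measures tend to 0 because the linked count is unbounded.\<close>

lemma respecting_null_set:
  assumes inf: "infinite {x. k x \<noteq> x}"
  shows "{A. \<forall>x. A x = A (k x)} \<in> null_sets cantor_measure"
proof -
  interpret prob_space cantor_measure by (rule prob_space_cantor_measure)
  let ?E = "{A. \<forall>x. A x = A (k x)}"
  have E: "?E = (\<Inter>L. {A. respects_below k L A})" by (auto simp: respects_iff)
  have meas: "?E \<in> sets cantor_measure"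
    unfolding E by (rule sets.countable_INT) (auto intro: respects_below_in_sets)
  have "measure cantor_measure ?E \<le> (1/2) ^ n" for n
  proof -
    obtain L where L: "n \<le> linked_count k L" using linked_count_unbounded[OF inf] .
    have "measure cantor_measure ?E \<le> measure cantor_measure {A. respects_below k L A}"
      by (rule finite_measure_mono[OF _ respects_below_in_sets]) (auto simp: E)
    also have "\<dots> \<le> (1/2) ^ linked_count k L" by (rule measure_respects_below)
    also have "\<dots> \<le> (1/2) ^ n" using L by (intro power_decreasing) auto
    finally show ?thesis .
  qed
  then have "measure cantor_measure ?E \<le> 0"
    by (intro LIMSEQ_le_const[OF LIMSEQ_power_zero[of "1/2"]]) auto
  then have "measure cantor_measure ?E = 0" by (simp add: measure_le_0_iff)
  then show ?thesis using meas by (simp add: null_sets_def emeasure_eq_measure)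
qed

instance recf :: countable
  by countable_datatype

lemma countable_total_computable: "countable {k. total_computable k}"
proof (rule countable_subset)
  show "{k. total_computable k} \<subseteq> range (\<lambda>p x. THE y. computes p [x] y)"
  proof
    fix k assume "k \<in> {k. total_computable k}"
    then obtain p where p: "\<And>x. computes p [x] (k x)" by (auto simp: total_computable_def)
    \<comment> \<open>By determinism the program fixes its function, so the countable type of
      programs maps onto a class containing all total computable functions.\<close>
    then have "k = (\<lambda>x. THE y. computes p [x] y)"
      by (intro ext the_equality[symmetric]) (auto intro: computes_deterministic)
    then show "k \<in> range (\<lambda>p x. THE y. computes p [x] y)" by blast
  qed
qed auto

text \<open>Failure of rigidity is witnessed by one of countably many functions, each of which
  contributes a null set.\<close>

lemma non_m_rigid_null_set: "{A. \<not> m_rigid A} \<in> null_sets cantor_measure"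
proof -
  have eq: "{A. \<not> m_rigid A}
      = (\<Union>k\<in>{k. total_computable k \<and> infinite {x. k x \<noteq> x}}. {A. \<forall>x. A x = A (k x)})"
    by (auto simp: m_rigid_def m_autoreduction_def)
  have "countable {k. total_computable k \<and> infinite {x. k x \<noteq> x}}"
    by (rule countable_subset[OF _ countable_total_computable]) auto
  then show ?thesis unfolding eq by (rule null_sets_UN') (use respecting_null_set in simp)
qed

theorem proposition4p1:
  shows "{A. m_rigid A} \<in> sets cantor_measure \<and> measure cantor_measure {A. m_rigid A} = 1 \<and>
    (\<forall>A. martin_loef_random A \<longrightarrow> m_rigid A)"
proof -
  interpret prob_space cantor_measure by (rule prob_space_cantor_measure)
  have "space cantor_measure = UNIV" by (simp add: cantor_measure_def space_PiM)
  then have eq: "{A. m_rigid A} = space cantor_measure - {A. \<not> m_rigid A}" by auto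
  have null: "{A. \<not> m_rigid A} \<in> sets cantor_measure" "measure cantor_measure {A. \<not> m_rigid A} = 0"
    using non_m_rigid_null_set by (auto simp: null_sets_def measure_def)
  have "{A. m_rigid A} \<in> sets cantor_measure"
    unfolding eq using null(1) by (rule sets.compl_sets)
  moreover have "measure cantor_measure {A. m_rigid A} = 1"
    unfolding eq using prob_compl[OF null(1)] null(2) by simp
  ultimately show ?thesis using martin_loef_random_imp_m_rigid by blast
qed

end
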